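(* Let $1\le p<\infty$ and $0<\lambda<1$. Then there exist equimeasurable functions $f,g:\mathbb{T}\to\mathbb{R}$ such that $g\in L^{p,\lambda}(\mathbb{T})$ but $f\notin L^{p,\lambda}(\mathbb{T})$.
   Context: $\mathbb{T}$ is the unit circle in $\mathbb{C}$ and $m$ is the Lebesgue (arc length) measure on $\mathbb{T}$ normalised so that $m(\mathbb{T})=1$. For $1\le p<\infty$ and $0\le\lambda<1$, the Morrey space $L^{p,\lambda}(\mathbb{T})$ is the collection of all measurable functions $f:\mathbb{T}\to\mathbb{C}$ such that $$\|f\|_{L^{p,\lambda}}:=\sup_{\omega\subset\mathbb{T}}\left(\frac{1}{m(\omega)^\lambda}\int_\omega |f(\zeta)|^p\,dm(\zeta)\right)^{1/p}<\infty,$$ where the supremum is taken over all arcs $\omega\subset\mathbb{T}$ (of positive measure). Two measurable functions $f,g:\mathbb{T}\to\mathbb{C}$ are said to be equimeasurable if $m\{\zeta\in\mathbb{T}:|f(\zeta)|>s\}=m\{\zeta\in\mathbb{T}:|g(\zeta)|>s\}$ for all $s\ge 0$. *)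

theory Defs
  imports "HOL-Analysis.Analysis"
begin

abbreviation unit_circle :: "complex set" where
  "unit_circle \<equiv> sphere 0 1"

text \<open>
  Normalised Lebesgue measure on the unit circle. The push-forward of the uniform measure on
  \<^term>\<open>{0..<2 * pi}\<close> lives on Borel sets only; the completion makes measurable mean
  Lebesgue measurable.
\<close>

definition circle_measure :: "complex measure" where
  "circle_measure =
     completion (distr (uniform_measure lborel {0..<2 * pi}) (restrict_space borel unit_circle) cis)"

text \<open>
  Arcs of positive measure: open, half-open and closed ones, and the full circle. The images
  under \<^const>\<open>cis\<close> of intervals are exactly the empty set, the points and the arcs.
\<close>

definition circle_arcs :: "complex set set" where
  "circle_arcs = {cis ` I | I. is_interval I \<and> emeasure circle_measure (cis ` I) > 0}"

definition ennreal_root :: "real \<Rightarrow> ennreal \<Rightarrow> ennreal" where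
  "ennreal_root p x = (if x = \<infinity> then \<infinity> else ennreal (enn2real x powr (1 / p)))"

definition morrey_norm :: "real \<Rightarrow> real \<Rightarrow> (complex \<Rightarrow> complex) \<Rightarrow> ennreal" where
  "morrey_norm p l f =
     (SUP \<omega>\<in>circle_arcs.
        ennreal_root p
          ((\<integral>\<^sup>+\<zeta>\<in>\<omega>. ennreal (norm (f \<zeta>) powr p) \<partial>circle_measure)
             / ennreal (measure circle_measure \<omega> powr l)))"

text \<open>
  Functions on the circle are total functions on \<^typ>\<open>complex\<close>; only their values on
  \<^const>\<open>unit_circle\<close> matter, both here and below.
\<close>

definition morrey_space :: "real \<Rightarrow> real \<Rightarrow> (complex \<Rightarrow> complex) set" where
  "morrey_space p l = {f \<in> borel_measurable circle_measure. morrey_norm p l f < \<infinity>}"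

definition equimeasurable :: "(complex \<Rightarrow> complex) \<Rightarrow> (complex \<Rightarrow> complex) \<Rightarrow> bool" where
  "equimeasurable f g \<longleftrightarrow>
     f \<in> borel_measurable circle_measure \<and> g \<in> borel_measurable circle_measure \<and>
     (\<forall>s\<ge>0. emeasure circle_measure {\<zeta> \<in> unit_circle. norm (f \<zeta>) > s} =
            emeasure circle_measure {\<zeta> \<in> unit_circle. norm (g \<zeta>) > s})"

end

theory Submission
  imports Defs
begin

text \<open>
  Both \<open>f\<close> and \<open>g\<close> live on the disjoint blocks \<open>[1/2^(n+1), 1/2^n)\<close> of the angle variable.
  On the \<open>n\<close>-th block, \<open>|f|\<^sup>p\<close> and \<open>|g|\<^sup>p\<close> equal \<open>1/\<delta>\<^sub>n\<close> on a set that fills the proportion \<open>\<delta>\<^sub>n\<close>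
  of the block and vanish elsewhere. For \<open>f\<close> this set is one interval, which violates the Morrey
  condition as \<open>n\<close> grows if \<open>\<delta>\<^sub>n\<close> is small enough. For \<open>g\<close> it is cut into so many equally spaced
  pieces that \<open>|g|\<^sup>p\<close> has an integral at most \<open>|J| + |J|\<^sup>\<lambda>\<close> over every interval \<open>J\<close>.
\<close>

subsection \<open>The angle coordinate on the circle\<close>

lemma borel_measurable_Arg2pi [measurable]: "Arg2pi \<in> borel_measurable borel"
  by (rule borel_measurable_iff_le[THEN iffD2])
     (auto intro!: borel_closed closed_Arg2pi2pi_le)

lemma Arg2pi_cis: "0 \<le> t \<Longrightarrow> t < 2 * pi \<Longrightarrow> Arg2pi (cis t) = t"
  by (rule Arg2pi_unique[of 1]) (auto simp: cis_conv_exp)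

lemma cis_Arg2pi: "norm z = 1 \<Longrightarrow> cis (Arg2pi z) = z"
  by (simp add: cis_conv_exp complex_norm_eq_1_exp)

lemma measurable_Arg2pi_circle [measurable]:
  "Arg2pi \<in> borel_measurable (restrict_space borel unit_circle)"
  by (rule measurable_restrict_space1) simp

lemma measurable_cis_circle [measurable]:
  "cis \<in> measurable borel (restrict_space borel unit_circle)"
  by (rule measurable_restrict_space2)
     (auto intro!: borel_measurable_continuous_onI continuous_intros)

lemma borel_measurable_circle_comp_Arg2pi:
  fixes h :: "real \<Rightarrow> 'a::topological_space"
  assumes [measurable]: "h \<in> borel_measurable borel"
  shows "(\<lambda>\<zeta>. h (Arg2pi \<zeta>)) \<in> borel_measurable circle_measure"
  unfolding circle_measure_def by (rule measurable_completion) simp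

text \<open>Completion leaves nonnegative integrals unchanged, and \<open>Arg2pi\<close> undoes
  \<open>cis\<close> on \<open>{0..<2*pi}\<close>, so this is the change of variables for the
  push-forward. Everything below is computed on the line through it.\<close>

lemma nn_integral_circle:
  assumes [measurable]: "H \<in> borel_measurable borel"
  shows "(\<integral>\<^sup>+\<zeta>. H (Arg2pi \<zeta>) \<partial>circle_measure)
           = (\<integral>\<^sup>+t\<in>{0..<2*pi}. H t \<partial>lborel) / ennreal (2 * pi)"
proof -
  have "(\<integral>\<^sup>+\<zeta>. H (Arg2pi \<zeta>) \<partial>circle_measure)
      = (\<integral>\<^sup>+t. H (Arg2pi (cis t)) \<partial>uniform_measure lborel {0..<2 * pi})"
    unfolding circle_measure_def nn_integral_completion
    by (subst nn_integral_distr) simp_all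
  also have "\<dots> = (\<integral>\<^sup>+t\<in>{0..<2*pi}. H (Arg2pi (cis t)) \<partial>lborel) / ennreal (2 * pi)"
    by (subst nn_integral_uniform_measure) simp_all
  also have "(\<integral>\<^sup>+t\<in>{0..<2*pi}. H (Arg2pi (cis t)) \<partial>lborel) = (\<integral>\<^sup>+t\<in>{0..<2*pi}. H t \<partial>lborel)"
    by (rule nn_integral_cong) (auto simp: indicator_def Arg2pi_cis)
  finally show ?thesis .
qed

lemma space_circle_measure: "space circle_measure = unit_circle"
  by (auto simp: circle_measure_def space_restrict_space)

lemma emeasure_circle:
  assumes [measurable]: "S \<in> sets borel"
  shows "emeasure circle_measure {\<zeta> \<in> unit_circle. Arg2pi \<zeta> \<in> S}
           = emeasure lborel (S \<inter> {0..<2*pi}) / ennreal (2 * pi)"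
proof -
  have m: "{\<zeta> \<in> unit_circle. Arg2pi \<zeta> \<in> S} \<in> sets circle_measure"
    using measurable_sets[OF borel_measurable_circle_comp_Arg2pi[of "\<lambda>t. t"], of S]
    by (simp add: space_circle_measure vimage_def Int_def conj_commute)
  have "emeasure circle_measure {\<zeta> \<in> unit_circle. Arg2pi \<zeta> \<in> S}
      = (\<integral>\<^sup>+\<zeta>. indicator {\<zeta> \<in> unit_circle. Arg2pi \<zeta> \<in> S} \<zeta> \<partial>circle_measure)"
    by (rule nn_integral_indicator[OF m, symmetric])
  also have "\<dots> = (\<integral>\<^sup>+\<zeta>. indicator S (Arg2pi \<zeta>) \<partial>circle_measure)"
    by (rule nn_integral_cong) (auto simp: indicator_def space_circle_measure)
  also have "\<dots> = (\<integral>\<^sup>+t. indicator (S \<inter> {0..<2*pi}) t \<partial>lborel) / ennreal (2 * pi)"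
    unfolding indicator_inter_arith by (rule nn_integral_circle) simp
  finally show ?thesis by simp
qed

lemma cis_add_2pi_int: "cis (t + 2 * pi * of_int k) = cis t"
  by (simp flip: cis_mult)

lemma Arg2pi_cis_floor: "Arg2pi (cis s) = s - 2 * pi * \<lfloor>s / (2 * pi)\<rfloor>"
proof -
  define k where "k = \<lfloor>s / (2 * pi)\<rfloor>"
  have "of_int k \<le> s / (2 * pi)" "s / (2 * pi) < of_int k + 1"
    unfolding k_def by linarith+
  then have "0 \<le> s - 2 * pi * k" "s - 2 * pi * k < 2 * pi"
    by (auto simp: field_simps)
  then have "Arg2pi (cis (s - 2 * pi * k)) = s - 2 * pi * k"
    by (rule Arg2pi_cis)
  moreover have "cis (s - 2 * pi * k) = cis s"
    using cis_add_2pi_int[of "s - 2 * pi * k" k] by simp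
  ultimately show ?thesis by (simp add: k_def)
qed

text \<open>An arc may run through the point 1, where the angle jumps, so a single interval of
  angles is not enough. Two always suffice: either \<open>I\<close> contains a full period and the
  arc is the whole circle, or \<open>I\<close> meets at most two consecutive periods.
  \<open>J\<close> and \<open>K\<close> may coincide or be empty.\<close>

lemma cis_image_interval:
  assumes "is_interval I"
  obtains J K where "is_interval J" "is_interval K" "J \<subseteq> {0..<2*pi}" "K \<subseteq> {0..<2*pi}"
    "cis ` I = {\<zeta> \<in> unit_circle. Arg2pi \<zeta> \<in> J \<union> K}"
proof (cases "\<exists>a\<in>I. \<exists>b\<in>I. a + 2 * pi \<le> b")
  case True
  then obtain a b where ab: "a \<in> I" "b \<in> I" "a + 2 * pi \<le> b" by blast
  have "\<zeta> \<in> cis ` I" if "norm \<zeta> = 1" for \<zeta>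
  proof -
    \<comment> \<open>The number of full turns that moves the angle of \<open>\<zeta>\<close> into
      \<open>{a..<a + 2*pi}\<close>, which lies in \<open>I\<close>.\<close>
    define k where "k = - \<lfloor>(Arg2pi \<zeta> - a) / (2 * pi)\<rfloor>"
    have "(Arg2pi \<zeta> - a) / (2 * pi) + k \<ge> 0" "(Arg2pi \<zeta> - a) / (2 * pi) + k < 1"
      unfolding k_def by linarith+
    then have "a \<le> Arg2pi \<zeta> + 2 * pi * k" "Arg2pi \<zeta> + 2 * pi * k \<le> b"
      using ab(3) by (auto simp: field_simps)
    then have "Arg2pi \<zeta> + 2 * pi * k \<in> I"
      using assms ab(1,2) unfolding is_interval_1 by blast
    then show ?thesis
      using cis_add_2pi_int[of "Arg2pi \<zeta>" k] cis_Arg2pi[OF that] by (metis imageI)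
  qed
  then have "cis ` I = {\<zeta> \<in> unit_circle. Arg2pi \<zeta> \<in> {0..<2*pi} \<union> {0..<2*pi}}"
    using Arg2pi by auto
  then show ?thesis
    using that[of "{0..<2*pi}" "{0..<2*pi}"] by (simp add: is_interval_co)
next
  case False
  \<comment> \<open>The index of the period \<open>{2*pi*q..<2*pi*(q + 1)}\<close> that contains
    \<open>s\<close>.\<close>
  define q where "q s = \<lfloor>s / (2 * pi)\<rfloor>" for s
  have q: "2 * pi * q s \<le> s" "s < 2 * pi * (q s + 1)" for s
  proof -
    have "of_int (q s) \<le> s / (2 * pi)" "s / (2 * pi) < of_int (q s) + 1"
      unfolding q_def by linarith+
    then show "2 * pi * q s \<le> s" "s < 2 * pi * (q s + 1)" by (auto simp: field_simps)
  qed
  \<comment> \<open>If the indices differed by two or more, a whole period would separate the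
    points.\<close>
  have near: "q b \<le> q a + 1" if "a \<in> I" "b \<in> I" for a b
  proof (rule ccontr)
    assume "\<not> ?thesis"
    then have "real_of_int (q a) + 2 \<le> q b" by linarith
    then have "2 * pi * (q a + 2) \<le> 2 * pi * q b" by simp
    then have "a + 2 * pi \<le> b"
      using q(2)[of a] q(1)[of b] by (simp add: algebra_simps)
    then show False using False that by blast
  qed
  \<comment> \<open>\<open>k\<close> is the least index that occurs. If \<open>I\<close> is nonempty
    and has no least index, two successive descents yield indices that differ by at least two,
    against \<open>near\<close>.\<close>
  obtain k where k: "\<And>s. s \<in> I \<Longrightarrow> q s = k \<or> q s = k + 1"
  proof (cases "\<exists>a0\<in>I. \<forall>s\<in>I. q a0 \<le> q s")
    case True
    then obtain a0 where "a0 \<in> I" "\<forall>s\<in>I. q a0 \<le> q s" by blast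
    then show ?thesis using that[of "q a0"] near[of a0] by force
  next
    case no_min: False
    show ?thesis
    proof (cases "I = {}")
      case True
      then show ?thesis using that by blast
    next
      case False
      then obtain a0 where a0: "a0 \<in> I" by blast
      then obtain a1 where a1: "a1 \<in> I" "q a1 < q a0" using no_min by (meson not_le)
      then obtain a2 where "a2 \<in> I" "q a2 < q a1" using no_min by (meson not_le)
      then show ?thesis using near[of a2 a0] a0 a1 by linarith
    qed
  qed
  \<comment> \<open>The part of \<open>I\<close> in the \<open>k\<close>-th period, shifted back to
    \<open>{0..<2*pi}\<close>.\<close>
  define J where "J k = {t \<in> {0..<2*pi}. t + 2 * pi * of_int k \<in> I}" for k
  have int: "is_interval (J k)" for k
    unfolding is_interval_1 J_def
  proof (clarsimp, goal_cases)
    case (1 a b x)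
    then show ?case
      using assms unfolding is_interval_1
      by (meson add_right_mono)
  qed
  have "cis ` I = {\<zeta> \<in> unit_circle. Arg2pi \<zeta> \<in> J k \<union> J (k + 1)}"
  proof (intro equalityI subsetI)
    fix \<zeta> assume "\<zeta> \<in> cis ` I"
    then obtain s where s: "s \<in> I" "\<zeta> = cis s" by blast
    have "Arg2pi \<zeta> \<in> J (q s)"
      using s Arg2pi[of \<zeta>] by (auto simp: J_def Arg2pi_cis_floor q_def)
    then show "\<zeta> \<in> {\<zeta> \<in> unit_circle. Arg2pi \<zeta> \<in> J k \<union> J (k + 1)}"
      using k[OF s(1)] s(2) by auto
  next
    fix \<zeta> assume *: "\<zeta> \<in> {\<zeta> \<in> unit_circle. Arg2pi \<zeta> \<in> J k \<union> J (k + 1)}"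
    then obtain j where "Arg2pi \<zeta> \<in> J j" by blast
    then have "Arg2pi \<zeta> + 2 * pi * of_int j \<in> I" by (simp add: J_def)
    then show "\<zeta> \<in> cis ` I"
      using cis_add_2pi_int[of "Arg2pi \<zeta>" j] cis_Arg2pi[of \<zeta>] * by (force intro: rev_image_eqI)
  qed
  moreover have "J j \<subseteq> {0..<2*pi}" for j by (auto simp: J_def)
  ultimately show ?thesis by (intro that[of "J k" "J (k + 1)"] int)
qed

subsection \<open>Equidistributed sets\<close>

lemma fmeasurable_Ico: "{a..<b::real} \<in> fmeasurable lborel"
  by (cases "a \<le> b") (auto simp: fmeasurable_def)

text \<open>Cut \<open>{a..<b}\<close> into equal cells and let \<open>B\<close> take the initial
  proportion \<open>\<delta>\<close> of each. A cell inside \<open>J\<close> contributes exactly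
  this proportion of its length. Only the first and the last cell that meet \<open>J\<close> can
  stick out of it, and fine cells make their contribution smaller than \<open>e\<close>.\<close>

lemma equidistributed_set:
  fixes a b \<delta> e :: real
  assumes "a < b" "0 < \<delta>" "\<delta> \<le> 1" "0 < e"
  obtains B where "B \<in> sets borel" "B \<subseteq> {a..<b}" "measure lborel B = \<delta> * (b - a)"
    "\<And>J. is_interval J \<Longrightarrow> measure lborel (B \<inter> J) \<le> \<delta> * measure lborel (J \<inter> {a..<b}) + e"
proof -
  \<comment> \<open>With cells of length \<open>(b - a) / M\<close>, this says that two cells
    together carry less than \<open>e\<close> of \<open>B\<close>.\<close>
  obtain M :: nat where M: "2 * \<delta> * (b - a) / e < M"
    using reals_Archimedean2 by blast
  have "0 < 2 * \<delta> * (b - a) / e" using assms by simp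
  then have "0 < real M" using M by linarith
  then have M0: "0 < M" by simp
  define h where "h = (b - a) / M"
  have h: "0 < h" and Mh: "M * h = b - a" using assms(1) M0 by (auto simp: h_def)
  have small: "2 * (\<delta> * h) \<le> e"
    using M M0 assms(4) unfolding h_def by (simp add: field_simps)
  have \<delta>h: "0 < \<delta> * h" "\<delta> * h \<le> h" using assms h by (auto simp: mult_left_le_one_le)
  \<comment> \<open>\<open>C k\<close> are the cells, \<open>D k\<close> the pieces chosen in
    them.\<close>
  define C where "C k = {a + real k * h..<a + real (Suc k) * h}" for k
  define D where "D k = {a + real k * h..<a + real k * h + \<delta> * h}" for k
  define B where "B = (\<Union>k<M. D k)"
  have DC: "D k \<subseteq> C k" for k using \<delta>h by (auto simp: C_def D_def algebra_simps)
  have cell_order: "x < y" if "x \<in> C i" "y \<in> C j" "i < j" for x y i j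
  proof -
    have "real (Suc i) * h \<le> real j * h" using that(3) h by (intro mult_right_mono) auto
    then show ?thesis using that by (auto simp: C_def)
  qed
  have dC: "disjnt (C i) (C j)" if "i \<noteq> j" for i j
    using that cell_order[of _ i _ j] cell_order[of _ j _ i]
    unfolding disjnt_def by (metis disjoint_iff less_irrefl linorder_neqE_nat)
  then have dD: "disjnt (D i) (D j)" if "i \<noteq> j" for i j
    using that DC unfolding disjnt_def by blast
  have Cab: "C k \<subseteq> {a..<b}" if "k < M" for k
  proof -
    have "real (Suc k) * h \<le> real M * h" using that h by (intro mult_right_mono) auto
    moreover have "0 \<le> real k * h" using h by simp
    ultimately show ?thesis using Mh by (auto simp: C_def)
  qed
  have fmC: "C k \<in> fmeasurable lborel" "D k \<in> fmeasurable lborel" for k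
    unfolding C_def D_def by (rule fmeasurable_Ico)+
  have mD: "measure lborel (D k) = \<delta> * h" and mC: "measure lborel (C k) = h" for k
    using \<delta>h h by (auto simp: C_def D_def algebra_simps)
  have B: "B \<in> sets borel" by (auto simp: B_def D_def)
  have Bab: "B \<subseteq> {a..<b}" using DC Cab by (fastforce simp: B_def)
  have "measure lborel B = (\<Sum>k<M. measure lborel (D k))"
    unfolding B_def
    by (rule measure_UNION') (use fmC dD in \<open>auto simp: pairwise_def\<close>)
  then have mB: "measure lborel B = \<delta> * (b - a)" unfolding mD using Mh by (simp add: mult.left_commute)
  have "measure lborel (B \<inter> J) \<le> \<delta> * measure lborel (J \<inter> {a..<b}) + e" if J: "is_interval J" for J
  proof -
    have Jb[measurable]: "J \<in> sets borel" by (rule real_interval_borel_measurable[OF J])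
    define K where "K = {k. k < M \<and> C k \<inter> J \<noteq> {}}"
    have fK: "finite K" by (simp add: K_def)
    show ?thesis
    proof (cases "K = {}")
      case True
      then have "B \<inter> J = {}" using DC by (fastforce simp: K_def B_def)
      then show ?thesis using assms by simp
    next
      case False
      \<comment> \<open>The cells strictly between the extreme ones that meet \<open>J\<close>;
        being an interval, \<open>J\<close> contains them. \<open>Min K\<close> and
        \<open>Max K\<close> may be equal, hence only an upper bound 2 for the number of boundary
        cells.\<close>
      define L where "L = K - {Min K, Max K}"
      have inside: "C k \<subseteq> J" if "k \<in> L" for k
      proof
        fix x assume x: "x \<in> C k"
        have "Min K \<in> K" "Max K \<in> K" using False fK by auto
        then obtain u v where uv: "u \<in> C (Min K)" "u \<in> J" "v \<in> C (Max K)" "v \<in> J"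
          by (auto simp: K_def)
        have "Min K < k" "k < Max K"
          using that fK Min_le[of K k] Max_ge[of K k] unfolding L_def by (auto simp: order_less_le)
        then have "u < x" "x < v" using cell_order uv x by blast+
        then show "x \<in> J" using J uv unfolding is_interval_1 by (meson less_imp_le)
      qed
      have fmJ: "C k \<inter> J \<in> fmeasurable lborel" "D k \<inter> J \<in> fmeasurable lborel" for k
        using fmC by (auto intro!: fmeasurable_Int_fmeasurable)
      have "B \<inter> J \<subseteq> (\<Union>k\<in>K. D k \<inter> J)" using DC by (fastforce simp: B_def K_def)
      then have "measure lborel (B \<inter> J) \<le> measure lborel (\<Union>k\<in>K. D k \<inter> J)"
        using fmJ fK B by (intro measure_mono_fmeasurable fmeasurable.finite_UN) auto
      also have "\<dots> \<le> (\<Sum>k\<in>K. measure lborel (D k \<inter> J))"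
        using fmJ(2)[THEN fmeasurableD] fK by (intro measure_UNION_le)
      also have "\<dots> \<le> (\<Sum>k\<in>L \<union> {Min K, Max K}. measure lborel (D k \<inter> J))"
        using fK by (intro sum_mono2) (auto simp: L_def)
      also have "\<dots> \<le> (\<Sum>k\<in>L. measure lborel (D k \<inter> J)) + (\<Sum>k\<in>{Min K, Max K}. measure lborel (D k \<inter> J))"
        using fK by (subst sum.union_disjoint) (auto simp: L_def)
      also have "(\<Sum>k\<in>{Min K, Max K}. measure lborel (D k \<inter> J)) \<le> 2 * (\<delta> * h)"
      proof -
        have le: "measure lborel (D k \<inter> J) \<le> \<delta> * h" for k
          unfolding mD[of k, symmetric] using fmC fmJ by (intro measure_mono_fmeasurable) auto
        have "(\<Sum>k\<in>{Min K, Max K}. measure lborel (D k \<inter> J)) \<le> real (card {Min K, Max K}) * (\<delta> * h)"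
          using le by (intro sum_bounded_above)
        also have "\<dots> \<le> 2 * (\<delta> * h)"
          using \<delta>h by (intro mult_right_mono) (auto simp: card_insert_if)
        finally show ?thesis .
      qed
      also have "(\<Sum>k\<in>L. measure lborel (D k \<inter> J)) = \<delta> * (\<Sum>k\<in>L. measure lborel (C k \<inter> J))"
        unfolding sum_distrib_left
      proof (rule sum.cong)
        fix k assume "k \<in> L"
        then have "D k \<inter> J = D k" "C k \<inter> J = C k" using inside DC by blast+
        then show "measure lborel (D k \<inter> J) = \<delta> * measure lborel (C k \<inter> J)"
          by (simp add: mD mC)
      qed simp
      also have "(\<Sum>k\<in>L. measure lborel (C k \<inter> J)) = measure lborel (\<Union>k\<in>L. C k \<inter> J)"
        by (rule measure_UNION'[symmetric])
           (use fmJ fK dC in \<open>auto simp: L_def pairwise_def disjnt_iff\<close>)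
      also have "\<dots> \<le> measure lborel (J \<inter> {a..<b})"
      proof (rule measure_mono_fmeasurable)
        show "(\<Union>k\<in>L. C k \<inter> J) \<subseteq> J \<inter> {a..<b}" using Cab by (auto simp: L_def K_def)
        show "(\<Union>k\<in>L. C k \<inter> J) \<in> sets lborel" using fmJ(1) fK by (auto simp: L_def C_def)
        have "{a..<b} \<inter> J \<in> fmeasurable lborel"
          by (rule fmeasurable_Int_fmeasurable) (auto intro: fmeasurable_Ico)
        then show "J \<inter> {a..<b} \<in> fmeasurable lborel" by (simp add: Int_commute)
      qed
      finally show ?thesis using assms(2) small by simp
    qed
  qed
  with that B Bab mB show ?thesis by blast
qed

text \<open>A constant error is useless for short \<open>J\<close>, where the trivial bound by the
  length \<open>r\<close> of \<open>J\<close> inside \<open>{a..<b}\<close> is better. Both bounds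
  together leave the error \<open>min r e\<close>, and splitting it into its powers
  \<open>1 - l\<close> and \<open>l\<close> bounds it by
  \<open>e powr (1 - l) * r powr l\<close>.\<close>

lemma equidistributed_set_powr:
  fixes a b \<delta> \<epsilon> l :: real
  assumes "a < b" "0 < \<delta>" "\<delta> \<le> 1" "0 < \<epsilon>" "0 < l" "l < 1"
  obtains B where "B \<in> sets borel" "B \<subseteq> {a..<b}" "measure lborel B = \<delta> * (b - a)"
    "\<And>J. is_interval J \<Longrightarrow> measure lborel (B \<inter> J)
        \<le> \<delta> * measure lborel (J \<inter> {a..<b}) + \<epsilon> * measure lborel (J \<inter> {a..<b}) powr l"
proof -
  \<comment> \<open>Chosen so that \<open>e powr (1 - l) = \<epsilon>\<close>.\<close>
  define e where "e = \<epsilon> powr (1 / (1 - l))"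
  have e: "0 < e" "e powr (1 - l) = \<epsilon>" using assms by (auto simp: e_def powr_powr)
  obtain B where B: "B \<in> sets borel" "B \<subseteq> {a..<b}" "measure lborel B = \<delta> * (b - a)"
    and bound: "\<And>J. is_interval J \<Longrightarrow> measure lborel (B \<inter> J) \<le> \<delta> * measure lborel (J \<inter> {a..<b}) + e"
    using equidistributed_set[OF assms(1-3) e(1)] by metis
  have "measure lborel (B \<inter> J) \<le> \<delta> * measure lborel (J \<inter> {a..<b}) + \<epsilon> * measure lborel (J \<inter> {a..<b}) powr l"
    if J: "is_interval J" for J
  proof -
    define r where "r = measure lborel (J \<inter> {a..<b})"
    have [measurable]: "J \<in> sets borel" by (rule real_interval_borel_measurable[OF J])
    have "{a..<b} \<inter> J \<in> fmeasurable lborel"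
      by (rule fmeasurable_Int_fmeasurable) (auto intro: fmeasurable_Ico)
    then have "measure lborel (B \<inter> J) \<le> r"
      unfolding r_def using B by (intro measure_mono_fmeasurable) (auto simp: Int_commute)
    moreover have "0 \<le> \<delta> * r" using assms by (simp add: r_def)
    ultimately have "measure lborel (B \<inter> J) \<le> \<delta> * r + min r e"
      using bound[OF J] by (simp add: r_def)
    also have "min r e \<le> \<epsilon> * r powr l"
    proof (cases "r = 0")
      case False
      then have r: "0 < r" by (simp add: r_def zero_less_measure_iff)
      have "min r e = min r e powr (1 - l) * min r e powr l"
        using r e by (simp flip: powr_add)
      also have "\<dots> \<le> e powr (1 - l) * r powr l"
        using r e assms by (intro mult_mono powr_mono2) auto
      finally show ?thesis using e by simp
    qed (use e in simp)
    finally show ?thesis by (simp add: r_def)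
  qed
  with that B show ?thesis by blast
qed

subsection \<open>The Morrey condition in the angle coordinate\<close>

text \<open>Removes the root from the Morrey norm, so that only the quotients under it need to be
  compared.\<close>

lemma ennreal_root_le_iff:
  assumes "0 < p" "0 \<le> R"
  shows "ennreal_root p x \<le> ennreal R \<longleftrightarrow> x \<le> ennreal (R powr p)"
proof (cases x)
  case (real y)
  have "y powr (1 / p) \<le> R \<longleftrightarrow> y \<le> R powr p"
  proof
    assume "y powr (1 / p) \<le> R"
    then have "(y powr (1 / p)) powr p \<le> R powr p" using assms by (intro powr_mono2) auto
    then show "y \<le> R powr p" using assms real by (simp add: powr_powr)
  next
    assume "y \<le> R powr p"
    then have "y powr (1 / p) \<le> (R powr p) powr (1 / p)" using assms real by (intro powr_mono2) auto
    then show "y powr (1 / p) \<le> R" using assms by (simp add: powr_powr)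
  qed
  then show ?thesis using real assms by (simp add: ennreal_root_def)
next
  case top
  then show ?thesis by (simp add: ennreal_root_def top_unique)
qed

text \<open>The functions of interest are \<open>p\<close>-th roots of some \<open>G\<close> with
  nonnegative values, so the power \<open>p\<close> in the Morrey norm gives back \<open>G\<close>
  itself.\<close>

lemma nn_integral_circle_arc:
  fixes G :: "real \<Rightarrow> real"
  assumes [measurable]: "G \<in> borel_measurable borel" "S \<in> sets borel"
    and "\<And>t. 0 \<le> G t" and "0 < p" and "S \<subseteq> {0..<2*pi}"
    and \<omega>: "\<omega> = {\<zeta> \<in> unit_circle. Arg2pi \<zeta> \<in> S}"
  shows "(\<integral>\<^sup>+\<zeta>\<in>\<omega>. ennreal (norm (complex_of_real (G (Arg2pi \<zeta>) powr (1 / p))) powr p) \<partial>circle_measure)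
         = (\<integral>\<^sup>+t\<in>S. ennreal (G t) \<partial>lborel) / ennreal (2 * pi)"
proof -
  have "(\<integral>\<^sup>+\<zeta>\<in>\<omega>. ennreal (norm (complex_of_real (G (Arg2pi \<zeta>) powr (1 / p))) powr p) \<partial>circle_measure)
      = (\<integral>\<^sup>+\<zeta>. ennreal (G (Arg2pi \<zeta>)) * indicator S (Arg2pi \<zeta>) \<partial>circle_measure)"
    using assms(3,4)
    by (intro nn_integral_cong) (auto simp: \<omega> powr_powr indicator_def space_circle_measure)
  also have "\<dots> = (\<integral>\<^sup>+t\<in>{0..<2*pi}. (ennreal (G t) * indicator S t) \<partial>lborel) / ennreal (2 * pi)"
    by (rule nn_integral_circle) simp
  also have "(\<integral>\<^sup>+t\<in>{0..<2*pi}. (ennreal (G t) * indicator S t) \<partial>lborel) = (\<integral>\<^sup>+t\<in>S. ennreal (G t) \<partial>lborel)"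
    using assms(5) by (intro nn_integral_cong) (auto simp: indicator_def)
  finally show ?thesis .
qed

lemma emeasure_circle_arc:
  assumes "S \<in> sets borel" "S \<subseteq> {0..<2*pi}" "\<omega> = {\<zeta> \<in> unit_circle. Arg2pi \<zeta> \<in> S}"
  shows "emeasure circle_measure \<omega> = ennreal (measure lborel S / (2 * pi))"
    and "measure circle_measure \<omega> = measure lborel S / (2 * pi)"
proof -
  have "S \<inter> {0..<2*pi} = S" using assms(2) by blast
  moreover have "emeasure lborel S \<noteq> \<infinity>"
    using emeasure_mono[of S "{0..<2*pi}" lborel] assms(2) by (auto simp: top_unique)
  ultimately show *: "emeasure circle_measure \<omega> = ennreal (measure lborel S / (2 * pi))"
    using emeasure_circle[OF assms(1)] assms(3)
    by (simp add: emeasure_eq_ennreal_measure divide_ennreal)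
  show "measure circle_measure \<omega> = measure lborel S / (2 * pi)"
    unfolding measure_def[of circle_measure] * by simp
qed

text \<open>Testing intervals of angles is enough: an arc consists of at most two of them, neither
  longer than the arc, and this costs a factor 2.\<close>

lemma morrey_space_Arg2piI:
  fixes G :: "real \<Rightarrow> real"
  assumes [measurable]: "G \<in> borel_measurable borel" and G: "\<And>t. 0 \<le> G t"
    and "0 < p" "0 \<le> l" "0 \<le> C"
    and bound: "\<And>J. is_interval J \<Longrightarrow> J \<subseteq> {0..<2*pi} \<Longrightarrow>
        (\<integral>\<^sup>+t\<in>J. ennreal (G t) \<partial>lborel) \<le> ennreal (C * measure lborel J powr l)"
  shows "(\<lambda>\<zeta>. complex_of_real (G (Arg2pi \<zeta>) powr (1 / p))) \<in> morrey_space p l"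
proof -
  \<comment> \<open>The 2 comes from the two intervals, the powers of \<open>2 * pi\<close> from the
    normalisation of the measure.\<close>
  define D where "D = 2 * C * (2 * pi) powr l / (2 * pi)"
  have D: "0 \<le> D" using assms by (simp add: D_def)
  have "morrey_norm p l (\<lambda>\<zeta>. complex_of_real (G (Arg2pi \<zeta>) powr (1 / p))) \<le> ennreal (D powr (1 / p))"
    unfolding morrey_norm_def
  proof (rule SUP_least)
    fix \<omega> assume "\<omega> \<in> circle_arcs"
    then obtain I where I: "is_interval I" "\<omega> = cis ` I" "0 < emeasure circle_measure \<omega>"
      by (auto simp: circle_arcs_def)
    obtain J K where JK: "is_interval J" "is_interval K" "J \<subseteq> {0..<2*pi}" "K \<subseteq> {0..<2*pi}"
      and \<omega>: "\<omega> = {\<zeta> \<in> unit_circle. Arg2pi \<zeta> \<in> J \<union> K}"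
      using cis_image_interval[OF I(1)] I(2) by metis
    have [measurable]: "J \<in> sets borel" "K \<in> sets borel"
      using JK by (auto intro: real_interval_borel_measurable)
    define S where "S = J \<union> K"
    have S[measurable]: "S \<in> sets borel" and S2: "S \<subseteq> {0..<2*pi}"
      using JK by (auto simp: S_def)
    define r where "r = measure lborel S"
    note arc = emeasure_circle_arc[OF S S2 \<omega>[folded S_def]]
    have r: "0 < r" using I(3) arc(1) by (simp add: r_def zero_less_divide_iff)
    \<comment> \<open>\<open>measure\<close> is 0 on sets of infinite measure, so
      \<open>0 < r\<close> gives finiteness.\<close>
    have fm: "S \<in> fmeasurable lborel"
      using r measure_eq_emeasure_eq_ennreal unfolding r_def fmeasurable_def
      by (auto simp: measure_def enn2real_positive_iff)
    have "measure lborel J \<le> r" "measure lborel K \<le> r"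
      unfolding r_def using fm by (auto intro!: measure_mono_fmeasurable simp: S_def)
    then have pw: "measure lborel J powr l \<le> r powr l" "measure lborel K powr l \<le> r powr l"
      using assms by (auto intro: powr_mono2)
    have "(\<integral>\<^sup>+t\<in>S. ennreal (G t) \<partial>lborel)
        \<le> (\<integral>\<^sup>+t. ennreal (G t) * indicator J t + ennreal (G t) * indicator K t \<partial>lborel)"
      by (intro nn_integral_mono) (auto simp: S_def indicator_def)
    also have "\<dots> = (\<integral>\<^sup>+t\<in>J. ennreal (G t) \<partial>lborel) + (\<integral>\<^sup>+t\<in>K. ennreal (G t) \<partial>lborel)"
      by (rule nn_integral_add) simp_all
    also have "\<dots> \<le> ennreal (C * measure lborel J powr l) + ennreal (C * measure lborel K powr l)"
      using JK by (intro add_mono bound)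
    also have "\<dots> = ennreal (C * measure lborel J powr l + C * measure lborel K powr l)"
      using assms by (simp add: ennreal_plus)
    also have "\<dots> \<le> ennreal (2 * C * r powr l)"
      using mult_left_mono[OF pw(1), of C] mult_left_mono[OF pw(2), of C] assms
      by (intro ennreal_leI) linarith
    finally have int: "(\<integral>\<^sup>+t\<in>S. ennreal (G t) \<partial>lborel) \<le> ennreal (2 * C * r powr l)" .
    have "(\<integral>\<^sup>+\<zeta>\<in>\<omega>. ennreal (norm (complex_of_real (G (Arg2pi \<zeta>) powr (1 / p))) powr p) \<partial>circle_measure)
        / ennreal (measure circle_measure \<omega> powr l)
      = (\<integral>\<^sup>+t\<in>S. ennreal (G t) \<partial>lborel) / ennreal (2 * pi) / ennreal ((r / (2 * pi)) powr l)"
      using nn_integral_circle_arc[OF assms(1) S G assms(3) S2 \<omega>[folded S_def]] arc(2)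
      by (simp add: r_def)
    also have "\<dots> \<le> ennreal (2 * C * r powr l) / ennreal (2 * pi) / ennreal ((r / (2 * pi)) powr l)"
      by (intro divide_right_mono_ennreal int)
    also have "\<dots> = ennreal (2 * C * r powr l / (2 * pi) / (r / (2 * pi)) powr l)"
      using assms r by (simp add: divide_ennreal)
    also have "2 * C * r powr l / (2 * pi) / (r / (2 * pi)) powr l = D"
      using r by (simp add: D_def powr_divide)
    also have "ennreal D = ennreal ((D powr (1 / p)) powr p)"
      using D assms by (simp add: powr_powr)
    finally show "ennreal_root p ((\<integral>\<^sup>+\<zeta>\<in>\<omega>. ennreal (norm (complex_of_real (G (Arg2pi \<zeta>) powr (1 / p))) powr p) \<partial>circle_measure)
        / ennreal (measure circle_measure \<omega> powr l)) \<le> ennreal (D powr (1 / p))"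
      using assms by (subst ennreal_root_le_iff) auto
  qed
  then have "morrey_norm p l (\<lambda>\<zeta>. complex_of_real (G (Arg2pi \<zeta>) powr (1 / p))) < \<infinity>"
    by (metis ennreal_less_top infinity_ennreal_def order_le_less_trans)
  moreover have "(\<lambda>\<zeta>. complex_of_real (G (Arg2pi \<zeta>) powr (1 / p))) \<in> borel_measurable circle_measure"
    by (rule borel_measurable_circle_comp_Arg2pi[of "\<lambda>t. complex_of_real (G t powr (1 / p))"]) measurable
  ultimately show ?thesis by (simp add: morrey_space_def)
qed

lemma ennreal_le_mult_if_divide_le:
  assumes "x / ennreal u \<le> ennreal w" "0 < u" "0 \<le> w"
  shows "x \<le> ennreal (w * u)"
proof (cases x)
  case (real y)
  then show ?thesis
    using assms by (simp add: divide_ennreal pos_divide_le_eq)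
next
  case top
  then show ?thesis using assms by (simp add: ennreal_top_divide top_unique)
qed

text \<open>Half-open intervals within one period are mapped to arcs directly, so the finite norm
  bounds their integrals once the root and the normalisation are undone.\<close>

lemma morrey_space_Arg2piD:
  fixes G :: "real \<Rightarrow> real"
  assumes [measurable]: "G \<in> borel_measurable borel" and G: "\<And>t. 0 \<le> G t" and "0 < p"
    and mem: "(\<lambda>\<zeta>. complex_of_real (G (Arg2pi \<zeta>) powr (1 / p))) \<in> morrey_space p l"
  obtains C where "0 \<le> C" "\<And>a b. 0 \<le> a \<Longrightarrow> a < b \<Longrightarrow> b \<le> 2 * pi \<Longrightarrow>
      (\<integral>\<^sup>+t\<in>{a..<b}. ennreal (G t) \<partial>lborel) \<le> ennreal (C * (b - a) powr l)"
proof -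
  define N where "N = morrey_norm p l (\<lambda>\<zeta>. complex_of_real (G (Arg2pi \<zeta>) powr (1 / p)))"
  obtain R where R: "0 \<le> R" "N = ennreal R"
    using mem by (cases N) (auto simp: morrey_space_def N_def)
  define C where "C = R powr p * (2 * pi) / (2 * pi) powr l"
  have "(\<integral>\<^sup>+t\<in>{a..<b}. ennreal (G t) \<partial>lborel) \<le> ennreal (C * (b - a) powr l)"
    if ab: "0 \<le> a" "a < b" "b \<le> 2 * pi" for a b
  proof -
    define \<omega> where "\<omega> = cis ` {a..<b}"
    have \<omega>: "\<omega> = {\<zeta> \<in> unit_circle. Arg2pi \<zeta> \<in> {a..<b}}"
    proof (intro equalityI subsetI)
      fix \<zeta> assume "\<zeta> \<in> \<omega>"
      then obtain t where t: "a \<le> t" "t < b" "\<zeta> = cis t" by (auto simp: \<omega>_def)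
      then show "\<zeta> \<in> {\<zeta> \<in> unit_circle. Arg2pi \<zeta> \<in> {a..<b}}"
        using Arg2pi_cis[of t] ab by simp
    next
      fix \<zeta> assume "\<zeta> \<in> {\<zeta> \<in> unit_circle. Arg2pi \<zeta> \<in> {a..<b}}"
      then show "\<zeta> \<in> \<omega>"
        using cis_Arg2pi[of \<zeta>] by (auto simp: \<omega>_def intro: rev_image_eqI)
    qed
    have S2: "{a..<b} \<subseteq> {0..<2*pi}" using ab by auto
    have S: "{a..<b} \<in> sets borel" by simp
    note arc = emeasure_circle_arc[OF S S2 \<omega>]
    have "0 < emeasure circle_measure \<omega>" using arc(1) ab by simp
    then have "\<omega> \<in> circle_arcs"
      unfolding circle_arcs_def \<omega>_def using is_interval_co[of a b] by blast
    then have "ennreal_root p ((\<integral>\<^sup>+\<zeta>\<in>\<omega>. ennreal (norm (complex_of_real (G (Arg2pi \<zeta>) powr (1 / p))) powr p) \<partial>circle_measure)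
        / ennreal (measure circle_measure \<omega> powr l)) \<le> ennreal R"
      unfolding R(2)[symmetric] N_def morrey_norm_def by (rule SUP_upper)
    then have *: "(\<integral>\<^sup>+t\<in>{a..<b}. ennreal (G t) \<partial>lborel) / ennreal (2 * pi)
          / ennreal (((b - a) / (2 * pi)) powr l) \<le> ennreal (R powr p)"
      using nn_integral_circle_arc[OF assms(1) S G assms(3) S2 \<omega>] arc(2) ab R(1) assms(3)
      by (simp add: ennreal_root_le_iff)
    define q where "q = ((b - a) / (2 * pi)) powr l"
    have q: "0 < q" using ab by (simp add: q_def)
    have "(\<integral>\<^sup>+t\<in>{a..<b}. ennreal (G t) \<partial>lborel) / ennreal (2 * pi) \<le> ennreal (R powr p * q)"
      using * q unfolding q_def[symmetric] by (rule ennreal_le_mult_if_divide_le) simp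
    then have "(\<integral>\<^sup>+t\<in>{a..<b}. ennreal (G t) \<partial>lborel) \<le> ennreal (R powr p * q * (2 * pi))"
      by (rule ennreal_le_mult_if_divide_le) (use q in simp_all)
    also have "R powr p * q * (2 * pi) = C * (b - a) powr l"
      using ab by (simp add: C_def q_def powr_divide)
    finally show ?thesis .
  qed
  moreover have "0 \<le> C" by (simp add: C_def)
  ultimately show ?thesis using that by blast
qed

subsection \<open>Step functions on disjoint sets\<close>

text \<open>For a disjoint family at most one term is nonzero at each point, so convergence is no
  issue.\<close>

definition step_fun :: "(nat \<Rightarrow> real) \<Rightarrow> (nat \<Rightarrow> real set) \<Rightarrow> real \<Rightarrow> real" where
  "step_fun c B x = (\<Sum>n. c n * indicator (B n) x)"

lemma step_fun_in:
  assumes "disjoint_family B" "x \<in> B n"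
  shows "step_fun c B x = c n"
proof -
  have "x \<notin> B k" if "k \<noteq> n" for k
    using assms that by (auto simp: disjoint_family_on_def)
  then have "step_fun c B x = (\<Sum>k\<in>{n}. c k * indicator (B k) x)"
    unfolding step_fun_def by (intro suminf_finite) auto
  then show ?thesis using assms(2) by simp
qed

lemma step_fun_out: "x \<notin> (\<Union>n. B n) \<Longrightarrow> step_fun c B x = 0"
  by (simp add: step_fun_def)

lemma borel_measurable_step_fun [measurable]:
  assumes [measurable]: "\<And>n. B n \<in> sets borel"
  shows "step_fun c B \<in> borel_measurable borel"
  unfolding step_fun_def[abs_def] by measurable

lemma step_fun_nonneg:
  "disjoint_family B \<Longrightarrow> (\<And>n. 0 \<le> c n) \<Longrightarrow> 0 \<le> step_fun c B x"
  by (cases "x \<in> (\<Union>n. B n)") (auto simp: step_fun_in step_fun_out)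

text \<open>Moves the series to \<open>ennreal\<close>, where sum and integral may be interchanged
  freely.\<close>

lemma ennreal_step_fun:
  assumes "disjoint_family B"
  shows "ennreal (step_fun c B x) = (\<Sum>n. ennreal (c n) * indicator (B n) x)"
proof (cases "x \<in> (\<Union>n. B n)")
  case True
  then obtain n where n: "x \<in> B n" by blast
  have "x \<notin> B k" if "k \<noteq> n" for k
    using assms n that by (auto simp: disjoint_family_on_def)
  then have "(\<Sum>k. ennreal (c k) * indicator (B k) x) = (\<Sum>k\<in>{n}. ennreal (c k) * indicator (B k) x)"
    by (intro suminf_finite) auto
  then show ?thesis using step_fun_in[OF assms n] n by simp
qed (simp add: step_fun_out)

lemma nn_integral_step_fun:
  assumes "disjoint_family B" and [measurable]: "\<And>n. B n \<in> sets borel" "J \<in> sets borel"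
  shows "(\<integral>\<^sup>+x\<in>J. ennreal (step_fun c B x) \<partial>lborel)
           = (\<Sum>n. ennreal (c n) * emeasure lborel (B n \<inter> J))"
proof -
  have "(\<integral>\<^sup>+x\<in>J. ennreal (step_fun c B x) \<partial>lborel)
      = (\<integral>\<^sup>+x. (\<Sum>n. ennreal (c n) * indicator (B n \<inter> J) x) \<partial>lborel)"
    using assms(1)
    by (intro nn_integral_cong) (auto simp: ennreal_step_fun indicator_def)
  also have "\<dots> = (\<Sum>n. \<integral>\<^sup>+x. ennreal (c n) * indicator (B n \<inter> J) x \<partial>lborel)"
    by (rule nn_integral_suminf) measurable
  finally show ?thesis by (simp add: nn_integral_cmult_indicator)
qed

text \<open>The superlevel set is the union of those \<open>B n\<close> with \<open>s < c n\<close>;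
  as \<open>0 \<le> s\<close>, points outside all \<open>B n\<close> never count. The result sees
  the sets only through their measures.\<close>

lemma emeasure_step_fun_level:
  assumes "disjoint_family B" and B: "\<And>n. B n \<in> sets borel" and "0 \<le> s"
  shows "emeasure lborel {x. s < step_fun c B x}
           = (\<Sum>n. if s < c n then emeasure lborel (B n) else 0)"
proof -
  have "{x. s < step_fun c B x} = (\<Union>n. if s < c n then B n else {})"
  proof (intro equalityI subsetI)
    fix x assume x: "x \<in> {x. s < step_fun c B x}"
    then have "x \<in> (\<Union>n. B n)" using step_fun_out[of x B c] assms(3) by force
    then obtain n where n: "x \<in> B n" by blast
    then have "s < c n" using x step_fun_in[OF assms(1) n] by simp
    then show "x \<in> (\<Union>n. if s < c n then B n else {})" using n by auto
  next
    fix x assume "x \<in> (\<Union>n. if s < c n then B n else {})"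
    then show "x \<in> {x. s < step_fun c B x}"
      using step_fun_in[OF assms(1)] by (auto split: if_splits)
  qed
  also have "emeasure lborel \<dots> = (\<Sum>n. emeasure lborel (if s < c n then B n else {}))"
    using assms by (intro suminf_emeasure[symmetric]) (auto simp: disjoint_family_on_def)
  also have "\<dots> = (\<Sum>n. if s < c n then emeasure lborel (B n) else 0)"
    by (intro suminf_cong) simp
  finally show ?thesis .
qed

text \<open>The root turns the level \<open>s\<close> into \<open>s powr p\<close>. The level sets
  lie in \<open>{0..<2*pi}\<close>, so their measure on the circle depends only on \<open>c\<close>
  and on the measures of the sets in the family.\<close>

lemma equimeasurable_step_fun:
  assumes A: "disjoint_family A" "\<And>n. A n \<in> sets borel" "\<And>n. A n \<subseteq> {0..<2*pi}"
    and B: "disjoint_family B" "\<And>n. B n \<in> sets borel" "\<And>n. B n \<subseteq> {0..<2*pi}"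
    and AB: "\<And>n. emeasure lborel (A n) = emeasure lborel (B n)"
    and c: "\<And>n. 0 \<le> c n" and p: "0 < p"
  shows "equimeasurable (\<lambda>\<zeta>. complex_of_real (step_fun c A (Arg2pi \<zeta>) powr (1 / p)))
                        (\<lambda>\<zeta>. complex_of_real (step_fun c B (Arg2pi \<zeta>) powr (1 / p)))"
proof -
  have meas: "(\<lambda>\<zeta>. complex_of_real (step_fun c S (Arg2pi \<zeta>) powr (1 / p))) \<in> borel_measurable circle_measure"
    if [measurable]: "\<And>n. S n \<in> sets borel" for S
    by (rule borel_measurable_circle_comp_Arg2pi[of "\<lambda>t. complex_of_real (step_fun c S t powr (1 / p))"])
       measurable
  have level: "emeasure circle_measure {\<zeta> \<in> unit_circle. s < norm (complex_of_real (step_fun c S (Arg2pi \<zeta>) powr (1 / p)))}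
      = (\<Sum>n. if s powr p < c n then emeasure lborel (S n) else 0) / ennreal (2 * pi)"
    if S: "disjoint_family S" "\<And>n. S n \<in> sets borel" "\<And>n. S n \<subseteq> {0..<2*pi}" and s: "0 \<le> s" for S s
  proof -
    note [measurable] = S(2)
    have root: "s < y powr (1 / p) \<longleftrightarrow> s powr p < y" if "0 \<le> y" for y :: real
    proof
      assume "s < y powr (1 / p)"
      then have "s powr p < (y powr (1 / p)) powr p" using p s by (intro powr_less_mono2) auto
      then show "s powr p < y" using p that by (simp add: powr_powr)
    next
      assume "s powr p < y"
      then have "(s powr p) powr (1 / p) < y powr (1 / p)" using p by (intro powr_less_mono2) auto
      then show "s < y powr (1 / p)" using p s by (simp add: powr_powr)
    qed
    define L where "L = {x. s powr p < step_fun c S x}"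
    have L: "L \<in> sets borel" unfolding L_def by measurable
    have "L \<subseteq> {0..<2*pi}"
    proof
      fix x assume "x \<in> L"
      then have "step_fun c S x \<noteq> 0" by (auto simp: L_def)
      then have "x \<in> (\<Union>n. S n)" using step_fun_out by blast
      then show "x \<in> {0..<2*pi}" using S(3) by blast
    qed
    then have "L \<inter> {0..<2*pi} = L" by blast
    moreover have "{\<zeta> \<in> unit_circle. s < norm (complex_of_real (step_fun c S (Arg2pi \<zeta>) powr (1 / p)))}
        = {\<zeta> \<in> unit_circle. Arg2pi \<zeta> \<in> L}"
      using root[OF step_fun_nonneg[OF S(1) c]] by (simp add: L_def)
    ultimately show ?thesis
      using emeasure_circle[OF L] emeasure_step_fun_level[OF S(1,2), of "s powr p" c] L_def by simp
  qed
  show ?thesis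
    unfolding equimeasurable_def
    using meas[of A] meas[of B] A(2) B(2) level[OF A] level[OF B] by (simp add: AB cong: if_cong)
qed

subsection \<open>The counterexample\<close>

theorem theorem1p1:
  fixes p l :: real
  assumes "1 \<le> p" and "0 < l" and "l < 1"
  shows "\<exists>f g :: complex \<Rightarrow> real.
           equimeasurable (\<lambda>\<zeta>. complex_of_real (f \<zeta>)) (\<lambda>\<zeta>. complex_of_real (g \<zeta>)) \<and>
           (\<lambda>\<zeta>. complex_of_real (g \<zeta>)) \<in> morrey_space p l \<and>
           (\<lambda>\<zeta>. complex_of_real (f \<zeta>)) \<notin> morrey_space p l"
proof -
  have p: "0 < p" using assms(1) by simp
  \<comment> \<open>Both the left endpoint and the length of the \<open>n\<close>-th block. That
    these numbers sum to 1 is used to add up the errors for \<open>g\<close>.\<close>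
  define L :: "nat \<Rightarrow> real" where "L n = (1 / 2) ^ Suc n" for n
  have L: "0 < L n" "L n \<le> 1 / 2" for n
    by (auto simp: L_def intro: power_le_one)
  define block where "block n = {L n..<2 * L n}" for n
  have disj_block: "disjoint_family block"
  proof -
    have *: "block m \<inter> block n = {}" if "m < n" for m n
    proof -
      have "L n \<le> (1 / 2) ^ Suc (Suc m)"
        unfolding L_def using that by (intro power_decreasing) auto
      then show ?thesis by (auto simp: block_def L_def)
    qed
    show ?thesis
      unfolding disjoint_family_on_def using * by (metis Int_commute linorder_neqE_nat)
  qed
  have block: "block n \<subseteq> {0..<2*pi}" for n
    using L[of n] pi_gt3 by (auto simp: block_def)
  \<comment> \<open>For \<open>f\<close>, the \<open>n\<close>-th interval has length
    \<open>\<delta> n * L n\<close> and carries the integral \<open>L n\<close>, so a Morrey bound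
    would give \<open>L n \<le> C * (\<delta> n * L n) powr l\<close>. With this choice the right
    side is \<open>C * L n / (n + 1)\<close>, which forces \<open>n + 1 \<le> C\<close>.\<close>
  define \<delta> where "\<delta> n = (L n powr (1 - l) / (real n + 1)) powr (1 / l)" for n
  have \<delta>0: "0 < \<delta> n" for n using L[of n] by (simp add: \<delta>_def)
  have \<delta>l: "\<delta> n powr l = L n powr (1 - l) / (real n + 1)" for n
    using assms L[of n] by (simp add: \<delta>_def powr_powr)
  have \<delta>1: "\<delta> n \<le> 1" for n
  proof -
    have "L n powr (1 - l) \<le> 1" using assms L[of n] by (intro powr_le1) auto
    then have "L n powr (1 - l) / (real n + 1) \<le> 1" using L[of n] by simp
    then show ?thesis unfolding \<delta>_def using assms L[of n] by (intro powr_le1) auto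
  qed
  \<comment> \<open>The height that gives both step functions mean value 1 on each block.\<close>
  define c where "c n = 1 / \<delta> n" for n
  have c: "0 \<le> c n" "c n * \<delta> n = 1" for n using \<delta>0[of n] by (auto simp: c_def)
  define A where "A n = {L n..<L n + \<delta> n * L n}" for n
  have A: "A n \<in> sets borel" "A n \<subseteq> block n" for n
    using L[of n] \<delta>1[of n] by (auto simp: A_def block_def mult_left_le_one_le intro: order_less_le_trans)
  have eA: "emeasure lborel (A n) = ennreal (\<delta> n * L n)" for n
    using L[of n] \<delta>0[of n] by (simp add: A_def)
  \<comment> \<open>The error factor is \<open>\<delta> n * L n\<close>: multiplication by the
    height \<open>c n\<close> leaves \<open>L n\<close>, which is summable.\<close>
  have "\<exists>B. B \<in> sets borel \<and> B \<subseteq> block n \<and> measure lborel B = \<delta> n * L n \<and>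
      (\<forall>J. is_interval J \<longrightarrow> measure lborel (B \<inter> J)
        \<le> \<delta> n * measure lborel (J \<inter> block n) + \<delta> n * L n * measure lborel (J \<inter> block n) powr l)" for n
  proof -
    have "L n < 2 * L n" "0 < \<delta> n * L n" using L[of n] \<delta>0[of n] by auto
    from equidistributed_set_powr[OF this(1) \<delta>0[of n] \<delta>1[of n] this(2) assms(2,3)]
    show ?thesis unfolding block_def by (smt (verit, best))
  qed
  then obtain B where B: "\<And>n. B n \<in> sets borel" "\<And>n. B n \<subseteq> block n"
    and mB: "\<And>n. measure lborel (B n) = \<delta> n * L n"
    and BJ: "\<And>n J. is_interval J \<Longrightarrow> measure lborel (B n \<inter> J)
        \<le> \<delta> n * measure lborel (J \<inter> block n) + \<delta> n * L n * measure lborel (J \<inter> block n) powr l"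
    by metis
  have fm: "S \<in> fmeasurable lborel" if "S \<in> sets borel" "S \<subseteq> {0..<2*pi}" for S :: "real set"
    using that fmeasurable_Ico[of 0 "2*pi"] fmeasurableI2 by (metis sets_lborel)
  have disjoint: "disjoint_family S" if "\<And>n. S n \<subseteq> block n" for S
    using disj_block that unfolding disjoint_family_on_def by blast
  have dA: "disjoint_family A" and dB: "disjoint_family B"
    using disjoint A(2) B(2) by auto
  have A2: "A n \<subseteq> {0..<2*pi}" and B2: "B n \<subseteq> {0..<2*pi}" for n
    using A(2) B(2) block by blast+
  have eAB: "emeasure lborel (A n) = emeasure lborel (B n)" for n
    using fm[OF B(1) B2, of n] mB[of n] eA[of n] by (simp add: emeasure_eq_measure2)
  define f where "f \<zeta> = step_fun c A (Arg2pi \<zeta>) powr (1 / p)" for \<zeta>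
  define g where "g \<zeta> = step_fun c B (Arg2pi \<zeta>) powr (1 / p)" for \<zeta>
  have "equimeasurable (\<lambda>\<zeta>. complex_of_real (f \<zeta>)) (\<lambda>\<zeta>. complex_of_real (g \<zeta>))"
    unfolding f_def g_def
    by (rule equimeasurable_step_fun[OF dA A(1) A2 dB B(1) B2 eAB c(1) p])
  moreover have "(\<lambda>\<zeta>. complex_of_real (g \<zeta>)) \<in> morrey_space p l"
    unfolding g_def
  proof (rule morrey_space_Arg2piI)
    show "step_fun c B \<in> borel_measurable borel" by (rule borel_measurable_step_fun[OF B(1)])
    show "0 \<le> step_fun c B t" for t by (rule step_fun_nonneg[OF dB c(1)])
    \<comment> \<open>The first summand of the constant absorbs the main term, as
      \<open>r \<le> 2 * pi\<close> gives \<open>r \<le> (2 * pi) powr (1 - l) * r powr l\<close>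
      for the length \<open>r\<close> of an interval. The summand 1 is for the errors, which add up
      to \<open>r powr l\<close>.\<close>
    show "0 < p" "0 \<le> l" "0 \<le> (2 * pi) powr (1 - l) + 1" using p assms by auto
    fix J :: "real set" assume J: "is_interval J" "J \<subseteq> {0..<2*pi}"
    have Jb[measurable]: "J \<in> sets borel" by (rule real_interval_borel_measurable[OF J(1)])
    have block_b[measurable]: "block n \<in> sets borel" for n by (simp add: block_def)
    define r where "r = measure lborel J"
    have r: "0 \<le> r" by (simp add: r_def)
    have eJ: "emeasure lborel J = ennreal r"
      unfolding r_def using fm[OF Jb J(2)] by (simp add: emeasure_eq_measure2)
    have fmJ: "J \<inter> block n \<in> fmeasurable lborel" for n
      using J(2) by (intro fm) auto
    have term_le: "ennreal (c n) * emeasure lborel (B n \<inter> J)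
        \<le> emeasure lborel (J \<inter> block n) + ennreal (r powr l * L n)" for n
    proof -
      define rn where "rn = measure lborel (J \<inter> block n)"
      have "rn \<le> r"
        unfolding rn_def r_def using fm[OF Jb J(2)] by (intro measure_mono_fmeasurable) auto
      then have "rn powr l \<le> r powr l" using assms by (intro powr_mono2) (auto simp: rn_def)
      have "c n * measure lborel (B n \<inter> J) \<le> c n * (\<delta> n * rn + \<delta> n * L n * rn powr l)"
        unfolding rn_def using BJ[OF J(1)] c(1) by (intro mult_left_mono)
      also have "\<dots> = c n * \<delta> n * (rn + L n * rn powr l)" by (simp add: algebra_simps)
      also have "\<dots> \<le> rn + r powr l * L n"
        using mult_left_mono[OF \<open>rn powr l \<le> r powr l\<close>, of "L n"] L[of n]
        unfolding c(2) by (simp add: mult.commute[of _ "L n"])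
      finally have "ennreal (c n * measure lborel (B n \<inter> J)) \<le> ennreal rn + ennreal (r powr l * L n)"
        using L[of n] by (simp add: rn_def flip: ennreal_plus)
      moreover have "B n \<inter> J \<in> fmeasurable lborel"
        using B(1) B2[of n] by (intro fm) auto
      ultimately show ?thesis
        using c(1)[of n] fmJ[of n] by (simp add: emeasure_eq_measure2 ennreal_mult rn_def)
    qed
    have "(\<integral>\<^sup>+t\<in>J. ennreal (step_fun c B t) \<partial>lborel) = (\<Sum>n. ennreal (c n) * emeasure lborel (B n \<inter> J))"
      by (rule nn_integral_step_fun[OF dB B(1) Jb])
    also have "\<dots> \<le> (\<Sum>n. emeasure lborel (J \<inter> block n) + ennreal (r powr l * L n))"
      by (intro suminf_le term_le) auto
    also have "\<dots> = (\<Sum>n. emeasure lborel (J \<inter> block n)) + (\<Sum>n. ennreal (r powr l * L n))"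
      by (rule suminf_add[symmetric]) auto
    \<comment> \<open>The blocks are disjoint, so the main terms add up to at most the length of
      \<open>J\<close>.\<close>
    also have "(\<Sum>n. emeasure lborel (J \<inter> block n)) = emeasure lborel (\<Union>n. J \<inter> block n)"
      using disj_block by (intro suminf_emeasure) (auto simp: disjoint_family_on_def)
    also have "\<dots> \<le> ennreal r"
      unfolding eJ[symmetric] by (intro emeasure_mono) auto
    also have "(\<Sum>n. ennreal (r powr l * L n)) = ennreal (r powr l)"
    proof -
      have "(\<lambda>n. r powr l * L n) sums (r powr l * 1)"
        unfolding L_def by (intro sums_mult power_half_series)
      then show ?thesis
        using L by (intro sums_unique[symmetric]) (simp add: less_imp_le)
    qed
    also have "ennreal r + ennreal (r powr l) = ennreal (r + r powr l)"
      using r by (simp add: ennreal_plus)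
    also have "\<dots> \<le> ennreal (((2 * pi) powr (1 - l) + 1) * r powr l)"
    proof (rule ennreal_leI)
      have "r \<le> measure lborel {0..<2*pi}"
        unfolding r_def using J(2) fmeasurable_Ico by (intro measure_mono_fmeasurable) auto
      then have "r powr (1 - l) \<le> (2 * pi) powr (1 - l)"
        using r assms by (intro powr_mono2) auto
      then have "r powr (1 - l) * r powr l \<le> (2 * pi) powr (1 - l) * r powr l"
        by (intro mult_right_mono) auto
      moreover have "r powr (1 - l) * r powr l = r"
        using r by (simp flip: powr_add)
      ultimately show "r + r powr l \<le> ((2 * pi) powr (1 - l) + 1) * r powr l"
        by (simp add: algebra_simps)
    qed
    finally show "(\<integral>\<^sup>+t\<in>J. ennreal (step_fun c B t) \<partial>lborel)
        \<le> ennreal (((2 * pi) powr (1 - l) + 1) * measure lborel J powr l)"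
      by (simp add: r_def add_mono)
  qed
  moreover have "(\<lambda>\<zeta>. complex_of_real (f \<zeta>)) \<notin> morrey_space p l"
  proof
    assume "(\<lambda>\<zeta>. complex_of_real (f \<zeta>)) \<in> morrey_space p l"
    from this[unfolded f_def] obtain C where C0: "0 \<le> C"
      and C: "\<And>a b. 0 \<le> a \<Longrightarrow> a < b \<Longrightarrow> b \<le> 2 * pi \<Longrightarrow>
        (\<integral>\<^sup>+t\<in>{a..<b}. ennreal (step_fun c A t) \<partial>lborel) \<le> ennreal (C * (b - a) powr l)"
      by (rule morrey_space_Arg2piD[OF borel_measurable_step_fun[OF A(1)] step_fun_nonneg[OF dA c(1)] p]) (rule that)
    have grow: "real n + 1 \<le> C" for n
    proof -
      have "\<delta> n * L n \<le> 1 * L n" using \<delta>1[of n] L[of n] by (intro mult_right_mono) auto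
      then have "L n + \<delta> n * L n \<le> 2 * pi" using L[of n] pi_gt3 by linarith
      moreover have "0 < \<delta> n * L n" using \<delta>0[of n] L[of n] by simp
      ultimately have "(\<integral>\<^sup>+t\<in>A n. ennreal (step_fun c A t) \<partial>lborel) \<le> ennreal (C * (\<delta> n * L n) powr l)"
        using C[of "L n" "L n + \<delta> n * L n"] L[of n] by (simp add: A_def)
      also have "(\<integral>\<^sup>+t\<in>A n. ennreal (step_fun c A t) \<partial>lborel) = (\<integral>\<^sup>+t\<in>A n. ennreal (c n) \<partial>lborel)"
        using step_fun_in[OF dA] by (intro nn_integral_cong) (auto simp: indicator_def)
      also have "\<dots> = ennreal (c n) * ennreal (\<delta> n * L n)"
        using A(1) by (simp add: nn_integral_cmult_indicator eA)
      also have "\<dots> = ennreal (L n)"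
        using c[of n] by (simp add: mult.assoc[symmetric] flip: ennreal_mult')
      finally have "L n \<le> C * (\<delta> n * L n) powr l"
        using C0 by (simp add: ennreal_le_iff)
      also have "\<dots> = C * (L n powr (1 - l) * L n powr l) / (real n + 1)"
        using L[of n] \<delta>0[of n] by (simp add: powr_mult \<delta>l)
      also have "L n powr (1 - l) * L n powr l = L n"
        using L[of n] by (simp flip: powr_add)
      finally have "L n * (real n + 1) \<le> L n * C" by (simp add: field_simps)
      then show ?thesis using L[of n] by simp
    qed
    obtain n where "C < real n" using reals_Archimedean2 by blast
    then show False using grow[of n] by simp
  qed
  ultimately show ?thesis by blast
qed

end
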